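(* Let $\mathcal{H}$ be a real Hilbert space, let $F=\sum_{i=1}^N F_i$ where each $F_i:\mathcal{H}\to\mathcal{H}$ satisfies $\|F_i(x)-F_i(y)\|\le L_i\|x-y\|^{\alpha_i}$ for all $x,y\in\mathcal{H}$, with $\alpha_i\in\left(\frac13,1\right]$ and $L_i>0$ ($i=1,\dots,N$). Let $G:\mathcal{H}\to 2^{\mathcal{H}}$ be maximally monotone, let $T:=F+G$ be monotone, and assume $\mathrm{SOL}:=\{x\in\mathcal{H}\mid 0\in T(x)\}\neq\emptyset$. Let $r>1$, $d\in(0,2(r-1))$, $\alpha=\min_{1\le i\le N}\alpha_i$ and $0<s\le\min_{1\le i\le N}\frac{1}{(N^2L_i^2\alpha_i)^{\frac{1}{2\alpha_i}}}$. Let $\{x_k\}$ be generated by the GSCEG algorithm (given in the context) from a starting point $x_0\in\mathcal{H}$. Then $$\mathrm{dist}\bigl(0,T(x_K)\bigr)^2\le O\left(\left(\frac{1}{(3\alpha-1)^2s^2}+\sum_{i=1}^N\frac{(1-\alpha_i)\ln(K)}{N\alpha_i}\right)K^{-(3\alpha-1)}\right).$$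
   Context: A set-valued operator $T:\mathcal{H}\to 2^{\mathcal{H}}$ is monotone if $\langle u-v,x-y\rangle\ge 0$ for all $x,y\in\mathcal{H}$, $u\in T(x)$, $v\in T(y)$; it is maximally monotone if moreover its graph $\{(x,u)\mid u\in T(x)\}$ is not a proper subset of the graph of another monotone operator. $T(x)=F(x)+G(x)=\{F(x)+g\mid g\in G(x)\}$. For $s>0$ and $G$ maximally monotone, $J_{sG}:=(I+sG)^{-1}$, which is a single-valued map defined on all of $\mathcal{H}$. For $x\in\mathcal{H}$ and $\mathcal{S}\subset\mathcal{H}$, $\mathrm{dist}(x,\mathcal{S})=\inf_{y\in\mathcal{S}}\|x-y\|$. The notation $O(\cdot)$ is as $K\to\infty$, with the problem data, the parameters and the starting point fixed (the implied constant does not depend on $K$). GSCEG algorithm (Generalized Symplectic Composite Extra-gradient Method). Initialization: $x_0\in\mathcal{H}$, $z_0=x_0$, $\tilde g_0=0$, $\Sigma_0=0$, and $r,d,s$ as in the claim. For $k=0,1,2,\dots$ set successively $$s_{k+1}=\frac{s}{(k+1)^{\frac{3(1-\alpha)}{2}}},\qquad \beta_{k+1}=\frac{rs_{k+1}}{2\Sigma_k+rs_{k+1}},\qquad \tilde x_{k+1}=\beta_{k+1}z_k+(1-\beta_{k+1})x_k,$$ $$x_{k+\frac12}=\tilde x_{k+1}-(1-\beta_{k+1})s_{k+1}\bigl(F(x_k)+\tilde g_k\bigr),\qquad x_{k+1}=J_{s_{k+1}G}\bigl(\tilde x_{k+1}-s_{k+1}F(x_{k+\frac12})\bigr),$$ $$\tilde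 g_{k+1}=s_{k+1}^{-1}\bigl(\tilde x_{k+1}-x_{k+1}-s_{k+1}F(x_{k+\frac12})\bigr),$$ $$z_{k+1}=z_k-\frac{ds_{k+1}}{2r}\bigl(F(x_{k+1})+\tilde g_{k+1}\bigr),\qquad \Sigma_{k+1}=\Sigma_k+\frac{s_{k+1}}{2}.$$ (The value of $\tilde g_0$ is irrelevant since $1-\beta_1=0$.) *)

theory Defs
  imports "HOL-Analysis.Analysis" "HOL-Library.Landau_Symbols"
begin

definition op_graph :: "('a \<Rightarrow> 'a set) \<Rightarrow> ('a \<times> 'a) set" where
  "op_graph T = {(x, u). u \<in> T x}"

definition monotone_op :: "('a::real_inner \<Rightarrow> 'a set) \<Rightarrow> bool" where
  "monotone_op T \<longleftrightarrow> (\<forall>x y. \<forall>u\<in>T x. \<forall>v\<in>T y. (u - v) \<bullet> (x - y) \<ge> 0)"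

definition maximally_monotone_op :: "('a::real_inner \<Rightarrow> 'a set) \<Rightarrow> bool" where
  "maximally_monotone_op T \<longleftrightarrow>
     monotone_op T \<and> \<not> (\<exists>S. monotone_op S \<and> op_graph T \<subset> op_graph S)"

definition op_plus :: "('a::real_vector \<Rightarrow> 'a) \<Rightarrow> ('a \<Rightarrow> 'a set) \<Rightarrow> 'a \<Rightarrow> 'a set" where
  "op_plus F G x = {F x + g |g. g \<in> G x}"

definition op_inverse :: "('a \<Rightarrow> 'a set) \<Rightarrow> 'a \<Rightarrow> 'a set" where
  "op_inverse T u = {x. u \<in> T x}"

text \<open>The resolvent \<open>(I + t G)\<inverse>\<close> as a set-valued operator. For monotone \<open>G\<close> and \<open>t > 0\<close> its
  values have at most one element (see \<open>resolvent_unique\<close> below); for maximally monotone \<open>G\<close> on a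
  Hilbert space they are singletons, by Minty's theorem. Hence \<open>x \<in> resolvent t G y\<close> says
  \<open>x = J\<^sub>t\<^sub>G(y)\<close>.\<close>

definition resolvent :: "real \<Rightarrow> ('a::real_vector \<Rightarrow> 'a set) \<Rightarrow> 'a \<Rightarrow> 'a set" where
  "resolvent t G = op_inverse (op_plus (\<lambda>x. x) (\<lambda>x. {t *\<^sub>R g |g. g \<in> G x}))"

lemma resolvent_unique:
  assumes "monotone_op G" "t > 0" "x \<in> resolvent t G y" "x' \<in> resolvent t G y"
  shows "x = x'"
proof -
  obtain g where g: "g \<in> G x" "y = x + t *\<^sub>R g"
    using assms(3) unfolding resolvent_def op_inverse_def op_plus_def by blast
  obtain g' where g': "g' \<in> G x'" "y = x' + t *\<^sub>R g'"
    using assms(4) unfolding resolvent_def op_inverse_def op_plus_def by blast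
  have e: "x - x' = - t *\<^sub>R (g - g')"
    using g(2) g'(2) by (simp add: algebra_simps)
  have "0 \<le> (g - g') \<bullet> (x - x')"
    using assms(1) g(1) g'(1) by (auto simp: monotone_op_def)
  then have "t * ((g - g') \<bullet> (g - g')) \<le> 0"
    unfolding e by simp
  then have "(g - g') \<bullet> (g - g') \<le> 0"
    using \<open>t > 0\<close> by (simp add: mult_le_0_iff)
  then have "g - g' = 0"
    by (metis inner_eq_zero_iff inner_ge_zero order_antisym)
  then show ?thesis using e by simp
qed

text \<open>\<open>gsceg F G r d s \<alpha> x\<^sub>0 x\<close>: the sequence \<open>x\<close> is generated by the GSCEG iteration started at
  \<open>x\<^sub>0\<close>. The remaining iterates are \<open>\<sigma> k = s\<^sub>k\<close>, \<open>S k = \<Sigma>\<^sub>k\<close>, \<open>\<beta> k\<close>, \<open>z k\<close>,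
  \<open>xt k\<close> and \<open>gt k\<close> (the tilde quantities with index \<open>k\<close>), and \<open>xh k\<close> (the half-step point with index
  \<open>k + 1/2\<close>). The values \<open>\<sigma> 0\<close>, \<open>\<beta> 0\<close>, \<open>xt 0\<close> are unconstrained and never used.\<close>

definition gsceg ::
  "('a::real_inner \<Rightarrow> 'a) \<Rightarrow> ('a \<Rightarrow> 'a set) \<Rightarrow> real \<Rightarrow> real \<Rightarrow> real \<Rightarrow> real \<Rightarrow> 'a \<Rightarrow> (nat \<Rightarrow> 'a) \<Rightarrow> bool"
  where
  "gsceg F G r d s \<alpha> x\<^sub>0 x \<longleftrightarrow>
    (\<exists>(\<sigma> :: nat \<Rightarrow> real) (\<beta> :: nat \<Rightarrow> real) (S :: nat \<Rightarrow> real) xt xh gt z.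
       x 0 = x\<^sub>0 \<and> z 0 = x 0 \<and> gt 0 = 0 \<and> S 0 = 0 \<and>
       (\<forall>k. \<sigma> (k + 1) = s / real (k + 1) powr (3 * (1 - \<alpha>) / 2) \<and>
            \<beta> (k + 1) = r * \<sigma> (k + 1) / (2 * S k + r * \<sigma> (k + 1)) \<and>
            xt (k + 1) = \<beta> (k + 1) *\<^sub>R z k + (1 - \<beta> (k + 1)) *\<^sub>R x k \<and>
            xh k = xt (k + 1) - ((1 - \<beta> (k + 1)) * \<sigma> (k + 1)) *\<^sub>R (F (x k) + gt k) \<and>
            x (k + 1) \<in> resolvent (\<sigma> (k + 1)) G (xt (k + 1) - \<sigma> (k + 1) *\<^sub>R F (xh k)) \<and>
            gt (k + 1) = inverse (\<sigma> (k + 1)) *\<^sub>R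
                           (xt (k + 1) - x (k + 1) - \<sigma> (k + 1) *\<^sub>R F (xh k)) \<and>
            z (k + 1) = z k - (d * \<sigma> (k + 1) / (2 * r)) *\<^sub>R (F (x (k + 1)) + gt (k + 1)) \<and>
            S (k + 1) = S k + \<sigma> (k + 1) / 2))"

text \<open>The library sets \<open>infdist y {} = 0\<close>. This convention does not affect the distance of \<open>0\<close> to
  \<open>(F + G)(x\<^sub>K)\<close> for \<open>K \<ge> 1\<close>, because that set is nonempty.\<close>

lemma gsceg_op_plus_nonempty:
  assumes "gsceg F G r d s \<alpha> x\<^sub>0 x" "K \<ge> 1"
  shows "op_plus F G (x K) \<noteq> {}"
proof -
  obtain k where K: "K = k + 1"
    using \<open>K \<ge> 1\<close> by (metis add.commute le_iff_add)
  obtain t y where "x K \<in> resolvent t G y"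
    using assms(1) unfolding gsceg_def K by blast
  then show ?thesis
    by (auto simp: resolvent_def op_inverse_def op_plus_def)
qed

end

theory Submission imports Defs begin

text \<open>
  Write \<open>f\<^sub>k = F(x\<^sub>k) + g\<^sub>k\<close> for the residual produced by the method. The resolvent step makes
  \<open>g\<^sub>k\<close> an element of \<open>G(x\<^sub>k)\<close> for \<open>k \<ge> 1\<close>, so \<open>f\<^sub>k \<in> T(x\<^sub>k)\<close> and \<open>dist(0, T(x\<^sub>k)) \<le> \<parallel>f\<^sub>k\<parallel>\<close>. For a
  zero \<open>p\<close> of \<open>T\<close> the proof follows the energy
  \<open>E\<^sub>k = (2 \<Sigma>\<^sub>k\<^sup>2 / r) \<parallel>f\<^sub>k\<parallel>\<^sup>2 + 2 \<Sigma>\<^sub>k \<langle>f\<^sub>k, x\<^sub>k - z\<^sub>k\<rangle> + (r (r - 1) / d) \<parallel>z\<^sub>k - p\<parallel>\<^sup>2\<close>.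

  The condition \<open>d < 2 (r - 1)\<close> is exactly the discriminant condition under which \<open>E\<^sub>k\<close>, reduced by
  the nonnegative term \<open>2 \<Sigma>\<^sub>k \<langle>f\<^sub>k, x\<^sub>k - p\<rangle>\<close>, is a positive definite form in \<open>\<Sigma>\<^sub>k f\<^sub>k\<close> and
  \<open>z\<^sub>k - p\<close>; hence \<open>E\<^sub>k\<close> controls \<open>\<Sigma>\<^sub>k\<^sup>2 \<parallel>f\<^sub>k\<parallel>\<^sup>2\<close> (\<open>energy_ge\<close>). Monotonicity of \<open>T\<close>
  between \<open>x\<^sub>k\<close> and \<open>x\<^sub>k\<^sub>+\<^sub>1\<close>, and between \<open>x\<^sub>k\<^sub>+\<^sub>1\<close> and \<open>p\<close>, shows that one iteration raises the
  energy by at most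
  \<open>(D\<^sup>2 / 2r) (\<parallel>F(x\<^sub>k\<^sub>+\<^sub>1) - F(x\<^sub>k\<^sub>+\<^sub>\<half>)\<parallel>\<^sup>2 - \<parallel>x\<^sub>k\<^sub>+\<^sub>1 - x\<^sub>k\<^sub>+\<^sub>\<half>\<parallel>\<^sup>2 / s\<^sub>k\<^sub>+\<^sub>1\<^sup>2)\<close> with
  \<open>D = 2 \<Sigma>\<^sub>k + r s\<^sub>k\<^sub>+\<^sub>1\<close> (\<open>energy_step\<close>).

  For Lipschitz \<open>F\<close> and a small step size the bracket is nonpositive. For Hoelder continuous \<open>F\<close> it
  is not, since \<open>t\<^sup>a\<close> exceeds every multiple of \<open>t\<close> near \<open>0\<close>; but \<open>t\<^sup>a\<close> lies below its
  tangent at \<open>t = s\<^sup>2 (k + 1)\<^sup>-\<^sup>3\<close>, and with the prescribed step sizes the slope of that tangent is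
  absorbed by \<open>1 / s\<^sub>k\<^sub>+\<^sub>1\<^sup>2\<close>, while its intercept is of order \<open>(k + 1)\<close> to the power \<open>-3 \<alpha>\<close>
  (\<open>hoelder_square_le\<close>, \<open>sum_hoelder_defect\<close>). As \<open>\<Sigma>\<^sub>k\<close> and \<open>D\<close> grow like \<open>k\<close> to the power
  \<open>q = (3 \<alpha> - 1) / 2\<close>, the increments of the energy are of order \<open>1 / (k + 1)\<close>. They add up to
  the logarithm in the rate, with the coefficient
  \<open>\<Sum>\<^sub>i (1 - \<alpha>\<^sub>i) / (N \<alpha>\<^sub>i)\<close>, and dividing by \<open>\<Sigma>\<^sub>K\<^sup>2\<close> gives the claim
  (\<open>gsceg_residual_bound\<close>).
\<close>

section \<open>Concavity of powers and sums of step sizes\<close>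

text \<open>The concave function \<open>y \<mapsto> y\<^sup>a\<close> lies below its tangent at \<open>t\<close>. The tangent point is left free
  because it is chosen differently in the two uses: the next integer in \<open>sum_powr_le\<close>, and
  a point that balances slope against intercept in \<open>hoelder_square_le\<close>.\<close>

lemma powr_le_tangent:
  fixes a y t :: real
  assumes "0 \<le> a" "a \<le> 1" "0 \<le> y" "0 < t"
  shows "y powr a \<le> a * t powr (a - 1) * y + (1 - a) * t powr a"
proof (cases "y = 0")
  case True
  then show ?thesis using assms by simp
next
  case False
  then have "y powr a * t powr (1 - a) \<le> a * y + (1 - a) * t"
    using Youngs_inequality_0[of a "1 - a" y t] assms by simp
  then have "y powr a * t powr (1 - a) * t powr (a - 1) \<le> (a * y + (1 - a) * t) * t powr (a - 1)"
    by (intro mult_right_mono) auto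
  moreover have "t powr (1 - a) * t powr (a - 1) = 1" "t * t powr (a - 1) = t powr a"
    using assms(4) by (simp_all add: powr_mult_base flip: powr_add)
  ultimately show ?thesis by (simp add: algebra_simps)
qed

text \<open>The tangent of \<open>y \<mapsto> y\<^sup>q\<close> at \<open>k + 1\<close>, evaluated at \<open>k\<close>, bounds the last summand by the increment
  of \<open>y\<^sup>q / q\<close>, so the sum telescopes.\<close>

lemma sum_powr_le:
  fixes q :: real
  assumes "0 < q" "q \<le> 1"
  shows "(\<Sum>j=1..k. real j powr (q - 1)) \<le> real k powr q / q"
proof (induction k)
  case (Suc k)
  have "real k powr q \<le> q * real (Suc k) powr (q - 1) * real k + (1 - q) * real (Suc k) powr q"
    using assms by (intro powr_le_tangent) auto
  moreover have "real (Suc k) powr q = real (Suc k) powr (q - 1) * (real k + 1)"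
    by (metis powr_mult_base mult.commute of_nat_0_le_iff of_nat_Suc add.commute diff_add_cancel)
  ultimately have "real k powr q + q * real (Suc k) powr (q - 1) \<le> real (Suc k) powr q"
    by (simp add: algebra_simps)
  then have "(real k powr q + q * real (Suc k) powr (q - 1)) / q \<le> real (Suc k) powr q / q"
    using assms by (intro divide_right_mono) auto
  then have "real k powr q / q + real (Suc k) powr (q - 1) \<le> real (Suc k) powr q / q"
    using assms by (simp add: add_divide_distrib)
  with Suc.IH show ?case by simp
qed simp

lemma sum_powr_ge:
  fixes q :: real
  assumes "q \<le> 1"
  shows "real k powr q \<le> (\<Sum>j=1..k. real j powr (q - 1))"
proof (cases "k = 0")
  case False
  have "real k powr q = (\<Sum>j=1..k. real k powr (q - 1))"
    using False by (simp add: powr_mult_base)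
  also have "\<dots> \<le> (\<Sum>j=1..k. real j powr (q - 1))"
    using assms by (intro sum_mono powr_mono2') auto
  finally show ?thesis .
qed simp

lemma harm_le_ln: "K \<ge> 1 \<Longrightarrow> harm K \<le> 1 + ln (real K)"
  using decseqD[OF decseq_harm_diff_ln, of 0 "K - 1"] by (simp add: harm_def)

section \<open>The error caused by Hoelder continuity\<close>

text \<open>The excess of a squared Hoelder modulus over the quadratic term that the energy can absorb.
  With \<open>B = n\<^sup>2 l\<^sup>2 a\<close> the condition on \<open>s\<close> reads \<open>B s\<^sup>2\<^sup>a \<le> 1\<close>. The tangent at
  \<open>t = s\<^sup>2 \<kappa>\<^sup>-\<^sup>3\<close> then has a slope below the inverse squared step size, because \<open>\<alpha> \<le> a\<close>, and an
  intercept of order \<open>\<kappa>\<close> to the power \<open>-3 \<alpha>\<close>. The factor \<open>1 - a\<close> of that intercept is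
  what removes the logarithm from the rate in the Lipschitz case.\<close>

lemma hoelder_square_le:
  fixes a \<alpha> s l n y \<kappa> :: real
  assumes "0 < a" "\<alpha> \<le> a" "a \<le> 1" "0 < n" "0 < l" "0 < s" "1 \<le> \<kappa>" "0 \<le> y"
    and s: "s \<le> 1 / (n\<^sup>2 * l\<^sup>2 * a) powr (1 / (2 * a))"
  shows "n * (l * y powr a)\<^sup>2 \<le>
           y\<^sup>2 / (n * (s / \<kappa> powr (3 * (1 - \<alpha>) / 2))\<^sup>2) + (1 - a) / (n * a) * \<kappa> powr (- (3 * \<alpha>))"
proof -
  define B where "B = n\<^sup>2 * l\<^sup>2 * a"
  have B: "0 < B" using assms by (simp add: B_def)
  have "s powr (2 * a) \<le> (1 / B powr (1 / (2 * a))) powr (2 * a)"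
    using s assms by (intro powr_mono2) (auto simp: B_def)
  also have "\<dots> = 1 / B"
    using B assms by (simp add: powr_divide powr_powr)
  finally have Bs: "B * s powr (2 * a) \<le> 1"
    using B by (simp add: field_simps)
  \<comment> \<open>For \<open>a < 1\<close>, \<open>\<alpha> = a\<close> and \<open>B s\<^sup>2\<^sup>a = 1\<close> this is the point where the excess is largest.\<close>
  define t where "t = s\<^sup>2 * \<kappa> powr (-3)"
  have t: "0 < t" using assms by (simp add: t_def)
  have s2: "s\<^sup>2 powr u = s powr (2 * u)" for u
    using assms by (simp add: powr_powr flip: powr_numeral)
  have y2: "(y powr a)\<^sup>2 = (y\<^sup>2) powr a"
    using assms(8) by (cases "y = 0") (auto simp: powr_powr mult.commute simp flip: powr_numeral)
  have ta: "t powr a = s powr (2 * a) * \<kappa> powr (- (3 * a))"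
    unfolding t_def using assms by (simp add: powr_mult s2 powr_powr)
  have "B * t powr a = (B * s powr (2 * a)) * \<kappa> powr (- (3 * a))"
    by (simp add: ta)
  also have "\<dots> \<le> 1 * \<kappa> powr (- (3 * \<alpha>))"
    using Bs assms by (intro mult_mono powr_mono) auto
  finally have 1: "B * t powr a \<le> \<kappa> powr (- (3 * \<alpha>))" by simp
  have ta1: "t powr (a - 1) = s powr (2 * a) / s\<^sup>2 * \<kappa> powr (3 * (1 - a))"
  proof -
    have "t powr (a - 1) = t powr a / t"
      using t by (simp add: powr_diff)
    also have "\<dots> = s powr (2 * a) / s\<^sup>2 * (\<kappa> powr (- (3 * a)) / \<kappa> powr (- 3))"
      unfolding ta by (simp add: t_def)
    also have "\<kappa> powr (- (3 * a)) / \<kappa> powr (- 3) = \<kappa> powr (- (3 * a) - (- 3))"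
      by (rule powr_diff[symmetric])
    also have "- (3 * a) - (- 3) = 3 * (1 - a)" by simp
    finally show ?thesis .
  qed
  have sig: "1 / (s / \<kappa> powr (3 * (1 - \<alpha>) / 2))\<^sup>2 = \<kappa> powr (3 * (1 - \<alpha>)) / s\<^sup>2"
  proof -
    have "(\<kappa> powr (3 * (1 - \<alpha>) / 2))\<^sup>2 = \<kappa> powr (3 * (1 - \<alpha>))"
      by (simp only: power2_eq_square powr_add[symmetric]) simp
    then show ?thesis by (simp add: power_divide)
  qed
  have "B * t powr (a - 1) = (B * s powr (2 * a)) * \<kappa> powr (3 * (1 - a)) / s\<^sup>2"
    by (simp add: ta1)
  also have "\<dots> \<le> 1 * \<kappa> powr (3 * (1 - \<alpha>)) / s\<^sup>2"
    using Bs assms by (intro divide_right_mono mult_mono powr_mono) auto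
  finally have 2: "B * t powr (a - 1) \<le> 1 / (s / \<kappa> powr (3 * (1 - \<alpha>) / 2))\<^sup>2"
    unfolding sig by simp
  have "n * (l * y powr a)\<^sup>2 = B / (n * a) * (y\<^sup>2) powr a"
  proof -
    have "B / (n * a) = n * l\<^sup>2"
      using assms(1,4) by (simp add: B_def power2_eq_square)
    then show ?thesis by (simp only: power_mult_distrib y2 mult.assoc)
  qed
  also have "\<dots> \<le> B / (n * a) * (a * t powr (a - 1) * y\<^sup>2 + (1 - a) * t powr a)"
    using B assms t by (intro mult_left_mono powr_le_tangent) auto
  also have "\<dots> = (B * t powr (a - 1)) * (y\<^sup>2 / n) + (1 - a) / (n * a) * (B * t powr a)"
    using assms by (simp add: field_simps)
  also have "\<dots> \<le> (1 / (s / \<kappa> powr (3 * (1 - \<alpha>) / 2))\<^sup>2) * (y\<^sup>2 / n)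
      + (1 - a) / (n * a) * \<kappa> powr (- (3 * \<alpha>))"
    using assms 1 2 by (intro add_mono mult_left_mono mult_right_mono) auto
  finally show ?thesis by (simp add: mult_ac)
qed

text \<open>Cauchy-Schwarz over the \<open>N\<close> summands costs a factor \<open>N\<close>, and each summand may use only the
  share \<open>1 / N\<close> of the quadratic term; this is where the factor \<open>N\<^sup>2\<close> in the condition on \<open>s\<close>
  comes from.\<close>

lemma sum_hoelder_defect:
  fixes Fi :: "nat \<Rightarrow> 'a::real_normed_vector \<Rightarrow> 'a"
  assumes N: "N \<ge> 1"
    and a: "\<And>i. i \<in> {1..N} \<Longrightarrow> 0 < a i \<and> \<alpha> \<le> a i \<and> a i \<le> 1"
    and L: "\<And>i. i \<in> {1..N} \<Longrightarrow> L i > 0"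
    and hoelder: "\<And>i y y'. i \<in> {1..N} \<Longrightarrow> norm (Fi i y - Fi i y') \<le> L i * norm (y - y') powr a i"
    and s: "0 < s" "\<And>i. i \<in> {1..N} \<Longrightarrow> s \<le> 1 / ((real N)\<^sup>2 * (L i)\<^sup>2 * a i) powr (1 / (2 * a i))"
    and \<kappa>: "1 \<le> \<kappa>"
  shows "(norm ((\<Sum>i=1..N. Fi i u) - (\<Sum>i=1..N. Fi i v)))\<^sup>2
     \<le> (norm (u - v))\<^sup>2 / (s / \<kappa> powr (3 * (1 - \<alpha>) / 2))\<^sup>2
        + (\<Sum>i=1..N. (1 - a i) / (real N * a i)) * \<kappa> powr (- (3 * \<alpha>))"
proof -
  let ?y = "norm (u - v)" and ?\<sigma> = "s / \<kappa> powr (3 * (1 - \<alpha>) / 2)"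
  have "norm ((\<Sum>i=1..N. Fi i u) - (\<Sum>i=1..N. Fi i v)) \<le> (\<Sum>i=1..N. norm (Fi i u - Fi i v))"
    by (metis norm_sum sum_subtractf)
  also have "\<dots> \<le> (\<Sum>i=1..N. L i * ?y powr a i)"
    by (intro sum_mono hoelder)
  finally have "(norm ((\<Sum>i=1..N. Fi i u) - (\<Sum>i=1..N. Fi i v)))\<^sup>2 \<le> (\<Sum>i=1..N. L i * ?y powr a i)\<^sup>2"
    by (intro power_mono) auto
  also have "\<dots> \<le> (\<Sum>i=1..N. (L i * ?y powr a i)\<^sup>2) * real N"
    using sum_squared_le_sum_of_squares[of "\<lambda>i. L i * ?y powr a i" "{1..N}"] by simp
  also have "\<dots> = (\<Sum>i=1..N. real N * (L i * ?y powr a i)\<^sup>2)"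
    by (simp add: sum_distrib_left mult.commute)
  also have "\<dots> \<le> (\<Sum>i=1..N. ?y\<^sup>2 / (real N * ?\<sigma>\<^sup>2) + (1 - a i) / (real N * a i) * \<kappa> powr (- (3 * \<alpha>)))"
    using a L s \<kappa> N by (intro sum_mono hoelder_square_le) auto
  also have "\<dots> = ?y\<^sup>2 / ?\<sigma>\<^sup>2 + (\<Sum>i=1..N. (1 - a i) / (real N * a i)) * \<kappa> powr (- (3 * \<alpha>))"
    using N by (simp add: sum.distrib sum_distrib_right)
  finally show ?thesis .
qed

section \<open>The energy of one iteration\<close>

text \<open>The three weights are forced by the proof of \<open>energy_step\<close>: the cross term is what
  monotonicity between consecutive iterates produces, the first weight makes the squares of the residuals
  telescope, and the third cancels the part of the cross term left over by \<open>D > 2 (S + \<sigma> / 2)\<close>.\<close>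

definition energy :: "real \<Rightarrow> real \<Rightarrow> 'a::real_inner \<Rightarrow> real \<Rightarrow> 'a \<Rightarrow> 'a \<Rightarrow> 'a \<Rightarrow> real" where
  "energy r d p S f x z =
     2 * S\<^sup>2 / r * (norm f)\<^sup>2 + 2 * S * (f \<bullet> (x - z)) + r * (r - 1) / d * (norm (z - p))\<^sup>2"

text \<open>Monotonicity at the zero \<open>p\<close> allows \<open>x\<close> to be replaced by \<open>p\<close> in the cross term; completing the
  square with the weight of \<open>\<parallel>z - p\<parallel>\<^sup>2\<close> leaves a multiple of \<open>S\<^sup>2 \<parallel>f\<parallel>\<^sup>2\<close> that is positive when
  \<open>d < 2 (r - 1)\<close>.\<close>

lemma energy_ge:
  assumes "1 < r" "0 < d" "0 \<le> S" "0 \<le> f \<bullet> (x - p)"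
  shows "(2 - d / (r - 1)) / r * (S\<^sup>2 * (norm f)\<^sup>2) \<le> energy r d p S f x z"
proof -
  define c where "c = r * (r - 1) / d"
  have c: "0 < c" using assms by (simp add: c_def)
  have "f \<bullet> (x - z) = f \<bullet> (x - p) - f \<bullet> (z - p)"
    by (simp add: inner_diff_right)
  also have "\<dots> \<ge> - (norm f * norm (z - p))"
    using assms(4) norm_cauchy_schwarz[of f "z - p"] by linarith
  finally have "2 * S * (f \<bullet> (x - z)) \<ge> 2 * S * (- (norm f * norm (z - p)))"
    using assms(3) by (intro mult_left_mono) auto
  moreover have "0 \<le> (S * norm f - c * norm (z - p))\<^sup>2 / c"
    using c by simp
  then have "2 * S * (norm f * norm (z - p)) \<le> S\<^sup>2 * (norm f)\<^sup>2 / c + c * (norm (z - p))\<^sup>2"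
    using c by (simp add: power2_diff field_simps power2_eq_square)
  ultimately have "energy r d p S f x z \<ge> 2 * S\<^sup>2 / r * (norm f)\<^sup>2 - S\<^sup>2 * (norm f)\<^sup>2 / c"
    unfolding energy_def c_def[symmetric] by linarith
  moreover have "(2 - d / (r - 1)) / r * (S\<^sup>2 * (norm f)\<^sup>2) = 2 * S\<^sup>2 / r * (norm f)\<^sup>2 - S\<^sup>2 * (norm f)\<^sup>2 / c"
    using assms by (simp add: c_def divide_simps) (simp add: algebra_simps)
  ultimately show ?thesis by simp
qed

text \<open>The equations for \<open>x'\<close> and for \<open>x' - xh\<close> are those of the iteration multiplied by \<open>D\<close>, which removes
  the quotient \<open>\<beta> = r \<sigma> / D\<close>; the vector \<open>e\<close> stands for \<open>F x' - F xh\<close>.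

  Monotonicity between \<open>x\<close> and \<open>x'\<close> is rewritten twice through the equation for \<open>x' - x\<close>, once
  for \<open>f\<close> (keeping \<open>x\<close>) and once for \<open>f'\<close> (passing to \<open>x'\<close>), which produces the two cross terms of
  the energy. The remaining products of residuals form a polarisation identity whose squares are those
  of \<open>f\<close>, \<open>f'\<close>, \<open>e\<close> and \<open>x' - xh\<close>. The part of \<open>\<parallel>f'\<parallel>\<^sup>2\<close> that does not telescope has a coefficient
  with the sign of \<open>d - 2 (r - 1)\<close>.\<close>

lemma energy_step:
  fixes x x' xh z z' p f f' e :: "'a::real_inner"
  assumes r: "1 < r" and d: "0 < d" "d \<le> 2 * (r - 1)" and S: "0 \<le> S" and \<sigma>: "0 < \<sigma>"
    and D: "D = 2 * S + r * \<sigma>"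
    and x': "D *\<^sub>R (x' - x) = (r * \<sigma>) *\<^sub>R (z - x) - (D * \<sigma>) *\<^sub>R (f' - e)"
    and w: "D *\<^sub>R (x' - xh) = (- \<sigma>) *\<^sub>R (D *\<^sub>R (f' - e) - (2 * S) *\<^sub>R f)"
    and z': "z' = z - (d * \<sigma> / (2 * r)) *\<^sub>R f'"
    and mono: "0 \<le> S * ((f' - f) \<bullet> (x' - x))"
    and sol: "0 \<le> f' \<bullet> (x' - p)"
  shows "energy r d p (S + \<sigma> / 2) f' x' z' \<le> energy r d p S f x z
           + D\<^sup>2 / (2 * r) * ((norm e)\<^sup>2 - (norm (x' - xh))\<^sup>2 / \<sigma>\<^sup>2)"
proof -
  have D0: "0 < D" using assms by (simp add: D add_nonneg_pos)
  have A: "D * (f \<bullet> (x' - x)) = r * \<sigma> * (f \<bullet> (z - x)) - D * \<sigma> * (f \<bullet> (f' - e))"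
    using arg_cong[OF x', of "\<lambda>v. f \<bullet> v"] by (simp add: inner_diff_right)
  have B: "D * (f' \<bullet> (x' - x)) = r * \<sigma> * (f' \<bullet> (z - x)) - D * \<sigma> * (f' \<bullet> (f' - e))"
    using arg_cong[OF x', of "\<lambda>v. f' \<bullet> v"] by (simp add: inner_diff_right)
  have B': "2 * S * (f' \<bullet> (x' - x)) = r * \<sigma> * (f' \<bullet> (z - x')) - D * \<sigma> * (f' \<bullet> (f' - e))"
    using B unfolding D by (simp add: algebra_simps inner_diff_right)
  have "0 \<le> 2 * D * (S * ((f' - f) \<bullet> (x' - x)))"
    using mono D0 by (intro mult_nonneg_nonneg[of "2 * D"]) auto
  also have "\<dots> = D * (2 * S * (f' \<bullet> (x' - x))) - 2 * S * (D * (f \<bullet> (x' - x)))"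
    by (simp add: inner_diff_left algebra_simps)
  also have "\<dots> = \<sigma> * (D * r * (f' \<bullet> (z - x')) - D\<^sup>2 * (f' \<bullet> (f' - e))
        - 2 * S * r * (f \<bullet> (z - x)) + 2 * S * D * (f \<bullet> (f' - e)))"
    unfolding A B' by (simp add: algebra_simps power2_eq_square)
  \<comment> \<open>With the factor \<open>\<sigma>\<close> divided out, the cross terms have weights proportional to \<open>D\<close> and \<open>2 S\<close>.\<close>
  finally have M: "0 \<le> D * r * (f' \<bullet> (z - x')) - D\<^sup>2 * (f' \<bullet> (f' - e))
        - 2 * S * r * (f \<bullet> (z - x)) + 2 * S * D * (f \<bullet> (f' - e))"
    using \<sigma> by (simp add: zero_le_mult_iff)
  have "D\<^sup>2 * (norm (x' - xh))\<^sup>2 = (norm (D *\<^sub>R (x' - xh)))\<^sup>2"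
    by (simp add: power_mult_distrib)
  also have "\<dots> = \<sigma>\<^sup>2 * (norm (D *\<^sub>R (f' - e) - (2 * S) *\<^sub>R f))\<^sup>2"
    unfolding w by (simp add: power_mult_distrib)
  finally have W: "D\<^sup>2 * ((norm (x' - xh))\<^sup>2 / \<sigma>\<^sup>2) = (norm (D *\<^sub>R (f' - e) - (2 * S) *\<^sub>R f))\<^sup>2"
    using \<sigma> by (simp add: field_simps)
  have P: "2 * (D\<^sup>2 * (f' \<bullet> (f' - e)) - 2 * S * D * (f \<bullet> (f' - e)))
      = D\<^sup>2 * (norm f')\<^sup>2 - 4 * S\<^sup>2 * (norm f)\<^sup>2 - D\<^sup>2 * ((norm e)\<^sup>2 - (norm (x' - xh))\<^sup>2 / \<sigma>\<^sup>2)"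
    unfolding right_diff_distrib W
    unfolding power2_norm_eq_inner
    by (simp add: inner_simps inner_commute power2_eq_square algebra_simps)
  have Z: "(norm (z' - p))\<^sup>2 = (norm (z - p))\<^sup>2 - d * \<sigma> / r * (f' \<bullet> (z - p)) + (d * \<sigma> / (2 * r))\<^sup>2 * (norm f')\<^sup>2"
    unfolding z' power2_norm_eq_inner
    by (simp add: inner_simps inner_commute power2_eq_square algebra_simps)
  have X: "f' \<bullet> (x' - z') = f' \<bullet> (x' - z) + d * \<sigma> / (2 * r) * (norm f')\<^sup>2"
    unfolding z' power2_norm_eq_inner by (simp add: inner_simps algebra_simps)
  \<comment> \<open>From here on only seven scalars matter; naming them turns the claim into a rational identity
    plus three sign conditions.\<close>
  define a where "a = f' \<bullet> (x' - z)"
  define n where "n = (norm f')\<^sup>2"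
  define m where "m = (norm f)\<^sup>2"
  define b where "b = f \<bullet> (x - z)"
  define c where "c = (norm (z - p))\<^sup>2"
  define h where "h = f' \<bullet> (x' - p)"
  define E where "E = D\<^sup>2 * ((norm e)\<^sup>2 - (norm (x' - xh))\<^sup>2 / \<sigma>\<^sup>2)"
  have zp: "f' \<bullet> (z - p) = h - a" by (simp add: h_def a_def inner_simps)
  have zx: "f' \<bullet> (z - x') = - a" "f \<bullet> (z - x) = - b" by (simp_all add: a_def b_def inner_simps)
  have M': "2 * r * D * a - 4 * r * S * b \<le> - D\<^sup>2 * n + 4 * S\<^sup>2 * m + E"
    using M P unfolding zx n_def[symmetric] m_def[symmetric] E_def[symmetric] by (simp add: algebra_simps)
  have "energy r d p (S + \<sigma> / 2) f' x' z' - energy r d p S f x z - E / (2 * r)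
     = (2 * r * D * a - 4 * r * S * b + D\<^sup>2 * n - 4 * S\<^sup>2 * m - E) / (2 * r)
       - (r - 1) * \<sigma> * h - (2 * (r - 1) - d) * (\<sigma> * (S + \<sigma> / 2) / r + (r - 1) * \<sigma>\<^sup>2 / (4 * r)) * n"
    unfolding energy_def Z X zp n_def[symmetric] m_def[symmetric] c_def[symmetric] a_def[symmetric]
      b_def[symmetric] D using r d
    by (simp add: field_simps power2_eq_square)
  also have "\<dots> \<le> 0"
  proof -
    have "(2 * r * D * a - 4 * r * S * b + D\<^sup>2 * n - 4 * S\<^sup>2 * m - E) / (2 * r) \<le> 0"
      using M' r by (intro divide_nonpos_pos) auto
    moreover have "0 \<le> (r - 1) * \<sigma> * h"
      using r \<sigma> sol by (simp add: h_def)
    moreover have "0 \<le> (2 * (r - 1) - d) * (\<sigma> * (S + \<sigma> / 2) / r + (r - 1) * \<sigma>\<^sup>2 / (4 * r)) * n"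
      using r \<sigma> d S by (intro mult_nonneg_nonneg add_nonneg_nonneg divide_nonneg_nonneg) (auto simp: n_def)
    ultimately show ?thesis by linarith
  qed
  finally show ?thesis by (simp add: E_def)
qed


section \<open>The rate\<close>

text \<open>Membership of the residual in \<open>T\<close> at the old point may fail when \<open>S = 0\<close>, as it does at the start,
  where the initial residual is a dummy value; every term of the energy that contains this residual then
  has the weight \<open>0\<close>.\<close>

lemma gsceg_step_energy:
  fixes F :: "'a::real_inner \<Rightarrow> 'a"
  assumes r: "1 < r" and d: "0 < d" "d \<le> 2 * (r - 1)" and S: "0 \<le> S" and \<sigma>: "0 < \<sigma>"
    and T: "monotone_op (op_plus F G)" and p: "0 \<in> op_plus F G p"
    and f: "S = 0 \<or> F x + g \<in> op_plus F G x"
    and \<beta>: "\<beta> = r * \<sigma> / (2 * S + r * \<sigma>)"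
    and xt: "xt = \<beta> *\<^sub>R z + (1 - \<beta>) *\<^sub>R x"
    and xh: "xh = xt - ((1 - \<beta>) * \<sigma>) *\<^sub>R (F x + g)"
    and x': "x' \<in> resolvent \<sigma> G (xt - \<sigma> *\<^sub>R F xh)"
    and g': "g' = inverse \<sigma> *\<^sub>R (xt - x' - \<sigma> *\<^sub>R F xh)"
    and z': "z' = z - (d * \<sigma> / (2 * r)) *\<^sub>R (F x' + g')"
  shows "F x' + g' \<in> op_plus F G x'"
    and "energy r d p (S + \<sigma> / 2) (F x' + g') x' z' \<le> energy r d p S (F x + g) x z
      + (2 * S + r * \<sigma>)\<^sup>2 / (2 * r) * ((norm (F x' - F xh))\<^sup>2 - (norm (x' - xh))\<^sup>2 / \<sigma>\<^sup>2)"
proof -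
  obtain h where h: "h \<in> G x'" "xt - \<sigma> *\<^sub>R F xh = x' + \<sigma> *\<^sub>R h"
    using x' unfolding resolvent_def op_inverse_def op_plus_def by blast
  have "xt - x' - \<sigma> *\<^sub>R F xh = \<sigma> *\<^sub>R h"
    using h(2) by (simp add: algebra_simps)
  then have "g' = h" using \<sigma> by (simp add: g')
  then show f': "F x' + g' \<in> op_plus F G x'"
    using h(1) by (auto simp: op_plus_def)
  define D where "D = 2 * S + r * \<sigma>"
  have D: "0 < D" using r \<sigma> S by (simp add: D_def add_nonneg_pos)
  have D\<beta>: "D * \<beta> = r * \<sigma>" "D * (1 - \<beta>) = 2 * S"
    using D by (simp_all add: \<beta> D_def[symmetric] right_diff_distrib) (simp add: D_def)
  have x'_eq: "x' = xt - \<sigma> *\<^sub>R (F x' + g' - (F x' - F xh))"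
    using h(2) \<open>g' = h\<close> by (simp add: algebra_simps)
  show "energy r d p (S + \<sigma> / 2) (F x' + g') x' z' \<le> energy r d p S (F x + g) x z
      + (2 * S + r * \<sigma>)\<^sup>2 / (2 * r) * ((norm (F x' - F xh))\<^sup>2 - (norm (x' - xh))\<^sup>2 / \<sigma>\<^sup>2)"
    unfolding D_def[symmetric]
  proof (rule energy_step[OF r d S \<sigma> D_def _ _ z'])
    have "x' - x = \<beta> *\<^sub>R (z - x) - \<sigma> *\<^sub>R (F x' + g' - (F x' - F xh))"
      by (subst x'_eq) (simp add: xt algebra_simps)
    then have "D *\<^sub>R (x' - x) = (D * \<beta>) *\<^sub>R (z - x) - (D * \<sigma>) *\<^sub>R (F x' + g' - (F x' - F xh))"
      by (simp add: scaleR_diff_right)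
    then show "D *\<^sub>R (x' - x) = (r * \<sigma>) *\<^sub>R (z - x) - (D * \<sigma>) *\<^sub>R (F x' + g' - (F x' - F xh))"
      by (simp only: D\<beta>)
    have "x' - xh = (- \<sigma>) *\<^sub>R ((F x' + g' - (F x' - F xh)) - (1 - \<beta>) *\<^sub>R (F x + g))"
      by (subst x'_eq) (simp add: xh algebra_simps)
    then have "D *\<^sub>R (x' - xh) = (- \<sigma>) *\<^sub>R (D *\<^sub>R (F x' + g' - (F x' - F xh)) - (D * (1 - \<beta>)) *\<^sub>R (F x + g))"
      by (simp add: scaleR_diff_right mult.left_commute mult.commute)
    then show "D *\<^sub>R (x' - xh) = (- \<sigma>) *\<^sub>R (D *\<^sub>R (F x' + g' - (F x' - F xh)) - (2 * S) *\<^sub>R (F x + g))"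
      by (simp only: D\<beta>)
    show "0 \<le> S * ((F x' + g' - (F x + g)) \<bullet> (x' - x))"
    proof (cases "S = 0")
      case False
      then have "0 \<le> (F x' + g' - (F x + g)) \<bullet> (x' - x)"
        using T f f' unfolding monotone_op_def by blast
      then show ?thesis using S by simp
    qed simp
    have "0 \<le> (F x' + g' - 0) \<bullet> (x' - p)"
      using T p f' unfolding monotone_op_def by blast
    then show "0 \<le> (F x' + g') \<bullet> (x' - p)" by simp
  qed
qed

text \<open>A bound with explicit constants for every \<open>K \<ge> 1\<close>: the energy starts at the multiple of
  \<open>\<parallel>x\<^sub>0 - p\<parallel>\<^sup>2\<close> on the right and grows by a harmonic sum, and \<open>\<Sigma>\<^sub>K \<ge> (s / 2) K\<^sup>q\<close>.\<close>

theorem gsceg_residual_bound: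
  fixes F :: "'a::real_inner \<Rightarrow> 'a"
  assumes N: "N \<ge> 1" and F: "F = (\<lambda>y. \<Sum>i=1..N. Fi i y)"
    and \<alpha>: "1 / 3 < \<alpha>" "\<alpha> \<le> 1"
    and a: "\<And>i. i \<in> {1..N} \<Longrightarrow> \<alpha> \<le> a i \<and> a i \<le> 1"
    and L: "\<And>i. i \<in> {1..N} \<Longrightarrow> L i > 0"
    and hoelder: "\<And>i y y'. i \<in> {1..N} \<Longrightarrow> norm (Fi i y - Fi i y') \<le> L i * norm (y - y') powr a i"
    and T: "monotone_op (op_plus F G)" and p: "0 \<in> op_plus F G p"
    and r: "1 < r" and d: "0 < d" "d < 2 * (r - 1)"
    and s: "0 < s" "\<And>i. i \<in> {1..N} \<Longrightarrow> s \<le> 1 / ((real N)\<^sup>2 * (L i)\<^sup>2 * a i) powr (1 / (2 * a i))"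
    and gen: "gsceg F G r d s \<alpha> x\<^sub>0 x"
    and K: "1 \<le> K"
  defines "q \<equiv> (3 * \<alpha> - 1) / 2"
  shows "(2 - d / (r - 1)) / r * (s / 2 * real K powr q)\<^sup>2 * (infdist 0 (op_plus F G (x K)))\<^sup>2
    \<le> r * (r - 1) / d * (norm (x\<^sub>0 - p))\<^sup>2
      + (s / q + r * s)\<^sup>2 / (2 * r) * (\<Sum>i=1..N. (1 - a i) / (real N * a i)) * (1 + ln (real K))"
proof -
  let ?A = "\<Sum>i=1..N. (1 - a i) / (real N * a i)"
  define C where "C = (s / q + r * s)\<^sup>2 / (2 * r) * ?A"
  obtain \<sigma> \<beta> S xt xh gt z where 0: "x 0 = x\<^sub>0" "z 0 = x 0" "S 0 = (0::real)"
    and gsceg: "\<And>k. \<sigma> (k + 1) = s / real (k + 1) powr (3 * (1 - \<alpha>) / 2)"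
      "\<And>k. \<beta> (k + 1) = r * \<sigma> (k + 1) / (2 * S k + r * \<sigma> (k + 1))"
      "\<And>k. xt (k + 1) = \<beta> (k + 1) *\<^sub>R z k + (1 - \<beta> (k + 1)) *\<^sub>R x k"
      "\<And>k. xh k = xt (k + 1) - ((1 - \<beta> (k + 1)) * \<sigma> (k + 1)) *\<^sub>R (F (x k) + gt k)"
      "\<And>k. x (k + 1) \<in> resolvent (\<sigma> (k + 1)) G (xt (k + 1) - \<sigma> (k + 1) *\<^sub>R F (xh k))"
      "\<And>k. gt (k + 1) = inverse (\<sigma> (k + 1)) *\<^sub>R (xt (k + 1) - x (k + 1) - \<sigma> (k + 1) *\<^sub>R F (xh k))"
      "\<And>k. z (k + 1) = z k - (d * \<sigma> (k + 1) / (2 * r)) *\<^sub>R (F (x (k + 1)) + gt (k + 1))"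
      "\<And>k. S (k + 1) = S k + \<sigma> (k + 1) / 2"
    using gen unfolding gsceg_def by metis
  have q: "0 < q" "q \<le> 1" using \<alpha> by (auto simp: q_def)
  have \<sigma>_eq: "\<sigma> (k + 1) = s * real (k + 1) powr (q - 1)" for k
  proof -
    have "q - 1 = - (3 * (1 - \<alpha>) / 2)" by (simp add: q_def field_simps)
    then show ?thesis unfolding gsceg(1) by (simp only: powr_minus divide_inverse)
  qed
  have \<sigma>_pos: "0 < \<sigma> (k + 1)" for k unfolding \<sigma>_eq using s(1) by simp
  have S_eq: "2 * S k = s * (\<Sum>j=1..k. real j powr (q - 1))" for k
  proof (induction k)
    case (Suc k)
    then show ?case using gsceg(8)[of k] \<sigma>_eq[of k] by (simp add: algebra_simps)
  qed (simp add: 0)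
  have S_upper: "2 * S k \<le> s / q * real (k + 1) powr q" for k
  proof -
    have "(\<Sum>j=1..k. real j powr (q - 1)) \<le> real k powr q / q"
      using q by (rule sum_powr_le)
    also have "\<dots> \<le> real (k + 1) powr q / q"
      using q by (intro divide_right_mono powr_mono2) auto
    finally have "s * (\<Sum>j=1..k. real j powr (q - 1)) \<le> s * (real (k + 1) powr q / q)"
      using s by (intro mult_left_mono) auto
    then show ?thesis by (simp add: S_eq)
  qed
  have S_lower: "s / 2 * real k powr q \<le> S k" for k
    using mult_left_mono[OF sum_powr_ge[OF q(2), of k] less_imp_le[OF s(1)]]
    unfolding S_eq[symmetric] by simp
  have S_nonneg: "0 \<le> S k" for k
    using S_lower[of k] s(1) by (meson order_trans mult_nonneg_nonneg powr_ge_zero less_imp_le half_gt_zero)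
  define f where "f k = F (x k) + gt k" for k
  have f: "k = 0 \<or> f k \<in> op_plus F G (x k)" for k
  proof (induction k)
    case (Suc k)
    have "S k = 0 \<or> F (x k) + gt k \<in> op_plus F G (x k)"
      using Suc 0 by (auto simp: f_def)
    from gsceg_step_energy(1)[OF r d(1) less_imp_le[OF d(2)] S_nonneg \<sigma>_pos T p this
        gsceg(2) gsceg(3) gsceg(4) gsceg(5) gsceg(6) gsceg(7)]
    show ?case by (simp add: f_def)
  qed simp
  let ?E = "\<lambda>k. energy r d p (S k) (f k) (x k) (z k)"
  have A: "0 \<le> ?A"
    using a \<alpha> by (intro sum_nonneg divide_nonneg_nonneg mult_nonneg_nonneg) (auto, fastforce)
  \<comment> \<open>The exponents cancel to \<open>2 q - 3 \<alpha> = - 1\<close>, the borderline case with logarithmic sums.\<close>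
  have step: "?E (Suc k) \<le> ?E k + C / real (k + 1)" for k
  proof -
    let ?D = "2 * S k + r * \<sigma> (k + 1)"
    let ?e = "F (x (k + 1)) - F (xh k)" and ?w = "x (k + 1) - xh k"
    have "S k = 0 \<or> F (x k) + gt k \<in> op_plus F G (x k)"
      using f[of k] 0 by (auto simp: f_def)
    from gsceg_step_energy(2)[OF r d(1) less_imp_le[OF d(2)] S_nonneg \<sigma>_pos T p this
        gsceg(2) gsceg(3) gsceg(4) gsceg(5) gsceg(6) gsceg(7)]
    have "?E (Suc k) \<le> ?E k + ?D\<^sup>2 / (2 * r) * ((norm ?e)\<^sup>2 - (norm ?w)\<^sup>2 / (\<sigma> (k + 1))\<^sup>2)"
      by (simp add: f_def gsceg(8)[simplified])
    also have "\<dots> \<le> ?E k + ?D\<^sup>2 / (2 * r) * (?A * real (k + 1) powr (- (3 * \<alpha>)))"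
    proof -
      have "(norm ?e)\<^sup>2 \<le> (norm ?w)\<^sup>2 / (\<sigma> (k + 1))\<^sup>2 + ?A * real (k + 1) powr (- (3 * \<alpha>))"
        unfolding F gsceg(1)
      proof (rule sum_hoelder_defect[OF N _ L hoelder s])
        show "0 < a i \<and> \<alpha> \<le> a i \<and> a i \<le> 1" if "i \<in> {1..N}" for i
          using a[OF that] \<alpha> by auto
      qed auto
      then show ?thesis using r by (intro add_left_mono mult_left_mono) auto
    qed
    also have "\<dots> \<le> ?E k + ((s / q + r * s) * real (k + 1) powr q)\<^sup>2 / (2 * r)
        * (?A * real (k + 1) powr (- (3 * \<alpha>)))"
    proof -
      have "real (k + 1) powr (q - 1) \<le> real (k + 1) powr q"
        by (intro powr_mono) auto
      then have "r * \<sigma> (k + 1) \<le> r * s * real (k + 1) powr q"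
        unfolding \<sigma>_eq using r s(1) by simp
      then have "?D \<le> (s / q + r * s) * real (k + 1) powr q"
        using S_upper[of k] by (simp add: algebra_simps)
      moreover have "0 \<le> ?D" using S_nonneg[of k] \<sigma>_pos[of k] r by simp
      ultimately show ?thesis
        using r A by (intro add_left_mono mult_right_mono divide_right_mono power_mono mult_nonneg_nonneg) auto
    qed
    also have "\<dots> = ?E k + C / real (k + 1)"
    proof -
      have "(real (k + 1) powr q)\<^sup>2 * real (k + 1) powr (- (3 * \<alpha>)) = real (k + 1) powr (2 * q - 3 * \<alpha>)"
        by (simp only: power2_eq_square powr_add[symmetric]) simp
      also have "2 * q - 3 * \<alpha> = - 1" by (simp add: q_def field_simps)
      also have "real (k + 1) powr (- 1) = 1 / real (k + 1)"
        by (simp add: powr_minus_divide)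
      finally have *: "(real (k + 1) powr q)\<^sup>2 * real (k + 1) powr (- (3 * \<alpha>)) = 1 / real (k + 1)" .
      have "((s / q + r * s) * real (k + 1) powr q)\<^sup>2 / (2 * r) * (?A * real (k + 1) powr (- (3 * \<alpha>)))
          = C * ((real (k + 1) powr q)\<^sup>2 * real (k + 1) powr (- (3 * \<alpha>)))"
        unfolding C_def power_mult_distrib by (simp only: times_divide_eq_left times_divide_eq_right mult_ac)
      then show ?thesis unfolding * by simp
    qed
    finally show ?thesis .
  qed
  have C: "0 \<le> C"
    unfolding C_def using A r by (intro mult_nonneg_nonneg divide_nonneg_nonneg) auto
  have "?E k \<le> ?E 0 + C * harm k" for k
  proof (induction k)
    case (Suc k)
    then show ?case using step[of k] by (simp add: harm_Suc algebra_simps divide_inverse)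
  qed (simp add: harm_def)
  then have "?E K \<le> ?E 0 + C * harm K" .
  also have "\<dots> \<le> r * (r - 1) / d * (norm (x\<^sub>0 - p))\<^sup>2 + C * (1 + ln (real K))"
    using C harm_le_ln[OF K] by (intro add_mono mult_left_mono) (auto simp: energy_def 0)
  finally have E: "?E K \<le> r * (r - 1) / d * (norm (x\<^sub>0 - p))\<^sup>2 + C * (1 + ln (real K))" .
  have fK: "f K \<in> op_plus F G (x K)" using f[of K] K by auto
  have "0 \<le> (f K - 0) \<bullet> (x K - p)"
    using T p fK unfolding monotone_op_def by blast
  then have "(2 - d / (r - 1)) / r * ((S K)\<^sup>2 * (norm (f K))\<^sup>2) \<le> ?E K"
    using r d S_nonneg by (intro energy_ge) auto
  moreover have "(2 - d / (r - 1)) / r * ((s / 2 * real K powr q)\<^sup>2 * (infdist 0 (op_plus F G (x K)))\<^sup>2)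
      \<le> (2 - d / (r - 1)) / r * ((S K)\<^sup>2 * (norm (f K))\<^sup>2)"
  proof (intro mult_left_mono mult_mono power_mono)
    show "infdist 0 (op_plus F G (x K)) \<le> norm (f K)"
      using infdist_le[OF fK, of 0] by simp
    show "0 \<le> (2 - d / (r - 1)) / r"
      using r d by (simp add: field_simps)
  qed (use S_lower s(1) in \<open>auto simp: infdist_nonneg\<close>)
  ultimately show ?thesis using E unfolding C_def by (simp only: mult.assoc)
qed

theorem theorem5:
  fixes F :: "'a::{real_inner, complete_space} \<Rightarrow> 'a"
    and Fi :: "nat \<Rightarrow> 'a \<Rightarrow> 'a"
    and G T :: "'a \<Rightarrow> 'a set"
    and N :: nat
    and L \<alpha>i :: "nat \<Rightarrow> real"
    and \<alpha> r d s :: real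
    and x\<^sub>0 :: 'a
    and x :: "nat \<Rightarrow> 'a"
  assumes "N \<ge> 1"
    and "F = (\<lambda>y. \<Sum>i=1..N. Fi i y)"
    and "\<And>i. i \<in> {1..N} \<Longrightarrow> 1/3 < \<alpha>i i \<and> \<alpha>i i \<le> 1"
    and "\<And>i. i \<in> {1..N} \<Longrightarrow> L i > 0"
    and "\<And>i y y'. i \<in> {1..N} \<Longrightarrow> norm (Fi i y - Fi i y') \<le> L i * norm (y - y') powr \<alpha>i i"
    and "maximally_monotone_op G"
    and "T = op_plus F G"
    and "monotone_op T"
    and "{y. 0 \<in> T y} \<noteq> {}"
    and "r > 1"
    and "0 < d" and "d < 2 * (r - 1)"
    and "\<alpha> = Min (\<alpha>i ` {1..N})"
    and "0 < s"
    and "s \<le> Min ((\<lambda>i. 1 / ((real N)\<^sup>2 * (L i)\<^sup>2 * \<alpha>i i) powr (1 / (2 * \<alpha>i i))) ` {1..N})"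
    and "gsceg F G r d s \<alpha> x\<^sub>0 x"
  shows "(\<lambda>K. (infdist 0 (T (x K)))\<^sup>2) \<in>
           O(\<lambda>K. (1 / ((3 * \<alpha> - 1)\<^sup>2 * s\<^sup>2) +
                    (\<Sum>i=1..N. (1 - \<alpha>i i) * ln (real K) / (real N * \<alpha>i i))) *
                 real K powr (- (3 * \<alpha> - 1)))"
proof -
  have \<alpha>_le: "\<alpha> \<le> \<alpha>i i" if "i \<in> {1..N}" for i
    using that by (simp add: assms(13))
  have "\<alpha> \<in> \<alpha>i ` {1..N}"
    unfolding assms(13) using assms(1) by (intro Min_in) auto
  then have \<alpha>: "1 / 3 < \<alpha>" "\<alpha> \<le> 1" using assms(3) by auto
  obtain p where p: "0 \<in> op_plus F G p" using assms(7,9) by auto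
  define q where "q = (3 * \<alpha> - 1) / 2"
  define A where "A = (\<Sum>i=1..N. (1 - \<alpha>i i) / (real N * \<alpha>i i))"
  define c0 where "c0 = 1 / ((3 * \<alpha> - 1)\<^sup>2 * s\<^sup>2)"
  define c where "c = (2 - d / (r - 1)) / r * (s / 2)\<^sup>2"
  define E where "E = r * (r - 1) / d * (norm (x\<^sub>0 - p))\<^sup>2"
  define C where "C = (s / q + r * s)\<^sup>2 / (2 * r)"
  have A: "0 \<le> A"
    unfolding A_def using assms(3)
    by (intro sum_nonneg divide_nonneg_nonneg mult_nonneg_nonneg) (auto, fastforce)
  have c0: "0 < c0" using \<alpha> assms(14) by (simp add: c0_def)
  have "0 < (2 - d / (r - 1)) / r" using assms(10-12) by (simp add: field_simps)
  then have c: "0 < c" unfolding c_def using assms(14) by (intro mult_pos_pos) auto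
  have E: "0 \<le> E" using assms(10-12) by (simp add: E_def)
  have C: "0 \<le> C" using assms(10) by (simp add: C_def)
  \<comment> \<open>The summand \<open>c0\<close> of the rate does not vary with \<open>K\<close> and is positive, so it dominates, up to a
    factor, all terms of the bound that are free of \<open>ln K\<close>.\<close>
  define M where "M = ((E + C * A) / c0 + C) / c"
  have "norm ((infdist 0 (T (x K)))\<^sup>2) \<le> M * norm ((c0 + (\<Sum>i=1..N. (1 - \<alpha>i i) * ln (real K) / (real N * \<alpha>i i))) *
                 real K powr (- (3 * \<alpha> - 1)))" if K: "K \<ge> 1" for K
  proof -
    let ?R = "(infdist 0 (T (x K)))\<^sup>2" and ?l = "ln (real K)"
    have l: "0 \<le> ?l" using K by simp
    have "c * (real K powr q)\<^sup>2 * ?R = (2 - d / (r - 1)) / r * (s / 2 * real K powr q)\<^sup>2 * ?R"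
      unfolding c_def power_mult_distrib by (simp only: mult.assoc)
    also have "\<dots> \<le> E + C * A * (1 + ?l)"
      unfolding E_def C_def A_def q_def assms(7)
      by (rule gsceg_residual_bound[where a = \<alpha>i, OF assms(1,2) \<alpha> _ assms(4,5) _ p assms(10-12,14) _ assms(16) K])
        (use \<alpha>_le assms(1,3,7,8,15) in auto)
    finally have "c * (real K powr q)\<^sup>2 * ?R \<le> E + C * A * (1 + ?l)" .
    moreover have "(real K powr q)\<^sup>2 = real K powr (3 * \<alpha> - 1)"
      by (simp add: power2_eq_square q_def flip: powr_add)
    ultimately have "c * real K powr (3 * \<alpha> - 1) * ?R \<le> E + C * A * (1 + ?l)"
      by simp
    also have "\<dots> \<le> ((E + C * A) / c0 + C) * (c0 + A * ?l)"
    proof -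
      have "((E + C * A) / c0 + C) * (c0 + A * ?l)
          = E + C * A * (1 + ?l) + ((E + C * A) / c0 * (A * ?l) + C * c0)"
        using c0 by (simp add: field_simps)
      moreover have "0 \<le> (E + C * A) / c0 * (A * ?l) + C * c0"
        using E C A c0 l by (intro add_nonneg_nonneg mult_nonneg_nonneg divide_nonneg_nonneg) auto
      ultimately show ?thesis by linarith
    qed
    finally have "?R \<le> M * ((c0 + A * ?l) * real K powr (- (3 * \<alpha> - 1)))"
    proof -
      let ?P = "real K powr (3 * \<alpha> - 1)" and ?U = "((E + C * A) / c0 + C) * (c0 + A * ?l)"
      assume "c * ?P * ?R \<le> ?U"
      moreover have "0 < c * ?P" using c K by simp
      ultimately have "?R \<le> ?U / (c * ?P)"
        by (simp add: pos_le_divide_eq mult.commute)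
      also have "?U / (c * ?P) = M * ((c0 + A * ?l) * real K powr (- (3 * \<alpha> - 1)))"
        unfolding M_def powr_minus[of _ "3 * \<alpha> - 1"] by (simp add: divide_inverse mult_ac)
      finally show ?thesis .
    qed
    also have "A * ?l = (\<Sum>i=1..N. (1 - \<alpha>i i) * ln (real K) / (real N * \<alpha>i i))"
      by (simp add: A_def sum_distrib_right)
    finally show ?thesis
      using \<open>A * ?l = _\<close>[symmetric] c0 A l by simp
  qed
  then have "\<forall>\<^sub>F K in sequentially. norm ((infdist 0 (T (x K)))\<^sup>2) \<le> M * norm ((c0 + (\<Sum>i=1..N. (1 - \<alpha>i i) * ln (real K) / (real N * \<alpha>i i))) *
                 real K powr (- (3 * \<alpha> - 1)))"
    using eventually_ge_at_top[of 1] by (rule eventually_mono[rotated])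
  then show ?thesis unfolding c0_def by (rule bigoI)
qed

end
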